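(* Let $G$ be a compact Vilenkin group. Then $\mathrm{GKdim}(\mathcal{O}(G))=0$.
   Context: A topological group $G$ is a compact Vilenkin group if it possesses a strictly decreasing sequence $G=G_0\supset G_1\supset G_2\supset\cdots$ of compact open normal subgroups of $G$ such that (i) $2\le |G_n/G_{n+1}|<\infty$ for all $n\in\mathbb{N}_0$; (ii) $(G_n)_{n\in\mathbb{N}_0}$ is a basis of neighbourhoods at the identity $e$ and $\bigcap_{n}G_n=\{e\}$. $\mathcal{O}(G)$ is the dense $*$-subalgebra of $C(G)$ generated by the matrix entries of irreducible unitary representations of $G$ (a unital $\mathbb{C}$-algebra). Gelfand–Kirillov dimension: for a unital algebra $\mathcal{A}$ over a field, let $\mathcal{V}$ be the set of all finite-dimensional subspaces of $\mathcal{A}$. For $V\in\mathcal{V}$ and $n\in\mathbb{N}_0$ let $V_n=\sum_{k=0}^nV^k$ be the subspace of elements expressible as sums of products of at most $n$ elements of $V$. Then $$\mathrm{GKdim}(\mathcal{A})=\sup_{V\in\mathcal{V}}\limsup_{n\to\infty}\frac{\log\dim(V_n)}{\log n}.$$ *)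

theory Defs
  imports
    "HOL-Analysis.Abstract_Topology"
    "HOL-Analysis.Product_Topology"
    "HOL-Library.Extended_Real"
    "HOL-Algebra.Coset"
    "Jordan_Normal_Form.VS_Connect"
    "Jordan_Normal_Form.Schur_Decomposition"
begin

hide_const (open) Multiset.mult Polynomial.smult Modules.module

section \<open>Compact Vilenkin groups\<close>

locale topological_group = group G for G :: "('a, 'b) monoid_scheme" (structure) +
  fixes T :: "'a topology"
  assumes topspace_eq: "topspace T = carrier G"
    and continuous_mult: "continuous_map (prod_topology T T) T (\<lambda>(x, y). x \<otimes> y)"
    and continuous_inv: "continuous_map T T (\<lambda>x. inv x)"

text \<open>Each \<open>N n\<close> is open and contains the identity, so the fundamental-system condition only has
  to say that every open neighbourhood of the identity contains some \<open>N n\<close>.\<close>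

locale compact_vilenkin_group = topological_group G T
  for G :: "('a, 'b) monoid_scheme" (structure) and T :: "'a topology" +
  assumes filtration:
    "\<exists>N :: nat \<Rightarrow> 'a set.
       N 0 = carrier G \<and>
       (\<forall>n. N (Suc n) \<subset> N n) \<and>
       (\<forall>n. compactin T (N n) \<and> openin T (N n) \<and> N n \<lhd> G) \<and>
       (\<forall>n. finite (carrier (G\<lparr>carrier := N n\<rparr> Mod N (Suc n))) \<and>
            2 \<le> card (carrier (G\<lparr>carrier := N n\<rparr> Mod N (Suc n)))) \<and>
       (\<forall>U. openin T U \<and> \<one> \<in> U \<longrightarrow> (\<exists>n. N n \<subseteq> U)) \<and>
       (\<Inter>n. N n) = {\<one>}"

section \<open>Irreducible unitary representations\<close>

definition unitary_group :: "nat \<Rightarrow> complex mat monoid" where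
  "unitary_group d =
     \<lparr>carrier = {A \<in> carrier_mat d d. mat_adjoint A * A = 1\<^sub>m d \<and> A * mat_adjoint A = 1\<^sub>m d},
      mult = (*), one = 1\<^sub>m d\<rparr>"

definition unitary_rep ::
  "('a, 'b) monoid_scheme \<Rightarrow> 'a topology \<Rightarrow> nat \<Rightarrow> ('a \<Rightarrow> complex mat) \<Rightarrow> bool" where
  "unitary_rep G T d \<pi> \<longleftrightarrow>
     \<pi> \<in> hom G (unitary_group d) \<and>
     (\<forall>i<d. \<forall>j<d. continuous_map T euclidean (\<lambda>x. \<pi> x $$ (i, j)))"

text \<open>Irreducible unitary representations of a compact group are finite-dimensional, so every one
  of them is, up to unitary equivalence, a representation by unitary matrices.\<close>

definition irreducible_unitary_rep ::
  "('a, 'b) monoid_scheme \<Rightarrow> 'a topology \<Rightarrow> nat \<Rightarrow> ('a \<Rightarrow> complex mat) \<Rightarrow> bool" where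
  "irreducible_unitary_rep G T d \<pi> \<longleftrightarrow>
     unitary_rep G T d \<pi> \<and> 0 < d \<and>
     (\<forall>W. VectorSpace.subspace class_ring W (module_vec TYPE(complex) d) \<and>
          (\<forall>x\<in>carrier G. \<forall>v\<in>W. \<pi> x *\<^sub>v v \<in> W) \<longrightarrow>
          W = {0\<^sub>v d} \<or> W = carrier_vec d)"

section \<open>The algebras \<open>C(G)\<close> and \<open>O(G)\<close>\<close>

text \<open>A function on the carrier is represented by its extensional extension (constantly
  \<^term>\<open>undefined\<close> off the carrier), so that equality in the algebra is equality on the group.\<close>

definition continuous_functions ::
  "('a, 'b) monoid_scheme \<Rightarrow> 'a topology \<Rightarrow> (complex, 'a \<Rightarrow> complex) module" where
  "continuous_functions G T =
     \<lparr>carrier = {f \<in> extensional (carrier G). continuous_map T euclidean f},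
      mult = (\<lambda>f g. \<lambda>x\<in>carrier G. f x * g x),
      one = (\<lambda>x\<in>carrier G. 1),
      zero = (\<lambda>x\<in>carrier G. 0),
      add = (\<lambda>f g. \<lambda>x\<in>carrier G. f x + g x),
      smult = (\<lambda>c f. \<lambda>x\<in>carrier G. c * f x)\<rparr>"

definition star_subalgebra ::
  "('a, 'b) monoid_scheme \<Rightarrow> 'a topology \<Rightarrow> ('a \<Rightarrow> complex) set \<Rightarrow> bool" where
  "star_subalgebra G T B \<longleftrightarrow>
     VectorSpace.subspace class_ring B (continuous_functions G T) \<and>
     \<one>\<^bsub>continuous_functions G T\<^esub> \<in> B \<and>
     (\<forall>f\<in>B. \<forall>g\<in>B. f \<otimes>\<^bsub>continuous_functions G T\<^esub> g \<in> B) \<and>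
     (\<forall>f\<in>B. (\<lambda>x\<in>carrier G. cnj (f x)) \<in> B)"

definition matrix_entries ::
  "('a, 'b) monoid_scheme \<Rightarrow> 'a topology \<Rightarrow> ('a \<Rightarrow> complex) set" where
  "matrix_entries G T =
     {(\<lambda>x\<in>carrier G. \<pi> x $$ (i, j)) | \<pi> d i j.
        irreducible_unitary_rep G T d \<pi> \<and> i < d \<and> j < d}"

definition representative_functions ::
  "('a, 'b) monoid_scheme \<Rightarrow> 'a topology \<Rightarrow> (complex, 'a \<Rightarrow> complex) module" where
  "representative_functions G T =
     (continuous_functions G T)
       \<lparr>carrier := \<Inter>{B. star_subalgebra G T B \<and> matrix_entries G T \<subseteq> B}\<rparr>"

section \<open>Gelfand--Kirillov dimension\<close>

text \<open>For the record \<open>A\<close> of a unital algebra over the field \<open>K\<close>. The empty list contributes the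
  unit, i.e.\ the summand \<open>V\<^sup>0\<close> spanned by the unit.\<close>

definition power_filtration ::
  "('k, 'r) ring_scheme \<Rightarrow> ('k, 'a, 'm) module_scheme \<Rightarrow> 'a set \<Rightarrow> nat \<Rightarrow> 'a set" where
  "power_filtration K A V n =
     LinearCombinations.module.span K A
       {foldr (mult A) vs \<one>\<^bsub>A\<^esub> | vs. set vs \<subseteq> V \<and> length vs \<le> n}"

definition GKdim ::
  "('k, 'r) ring_scheme \<Rightarrow> ('k, 'a, 'm) module_scheme \<Rightarrow> ereal" where
  "GKdim K A =
     (SUP V \<in> {V. VectorSpace.subspace K V A \<and> vectorspace.fin_dim K (A\<lparr>carrier := V\<rparr>)}.
        limsup (\<lambda>n. ereal (
          ln (real (vectorspace.dim K (A\<lparr>carrier := power_filtration K A V n\<rparr>))) / ln (real n))))"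

end

theory Submission
  imports Defs "HOL-Analysis.Abstract_Limits" "HOL-Analysis.Elementary_Metric_Spaces"
begin

text \<open>
  A continuous finite-dimensional representation maps a small neighbourhood of the identity close to
  the identity matrix, and the identity is the only matrix all of whose powers stay close to it.
  Hence the representation is trivial on some member \<open>N n\<close> of the filtration, and every representative
  function is constant on the cosets of some \<open>N n\<close>. By compactness \<open>N n\<close> has finite index, so a
  finite-dimensional subspace of \<open>O(G)\<close> lies in the finite-dimensional algebra of functions on
  finitely many cosets, together with all its powers: the dimensions of its powers are bounded.
\<close>

section \<open>Linear sets of functions on the group as vector spaces\<close>

text \<open>Only the carrier changes and the pointwise operations stay, so \<open>W\<close> may
  contain discontinuous functions. O(G), its subspaces and \<open>functions_through\<close> all get
  the same record shape.\<close>

abbreviation function_space ::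
  "('a, 'b) monoid_scheme \<Rightarrow> 'a topology \<Rightarrow> ('a \<Rightarrow> complex) set \<Rightarrow> (complex, 'a \<Rightarrow> complex) module" where
  "function_space G T W \<equiv> continuous_functions G T\<lparr>carrier := W\<rparr>"

text \<open>Free of topology and of any ambient module, so one set can be regarded as a subspace of
  several spaces. The two subspace lemmas below translate to and from
  \<open>VectorSpace.subspace\<close>.\<close>

definition linear_function_set :: "'a set \<Rightarrow> ('a \<Rightarrow> complex) set \<Rightarrow> bool" where
  "linear_function_set X W \<longleftrightarrow>
     W \<subseteq> extensional X \<and> (\<lambda>x\<in>X. 0) \<in> W \<and>
     (\<forall>f\<in>W. \<forall>g\<in>W. (\<lambda>x\<in>X. f x + g x) \<in> W) \<and> (\<forall>c. \<forall>f\<in>W. (\<lambda>x\<in>X. c * f x) \<in> W)"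

lemma linear_function_set_add:
  "linear_function_set X W \<Longrightarrow> f \<in> W \<Longrightarrow> g \<in> W \<Longrightarrow> (\<lambda>x\<in>X. f x + g x) \<in> W"
  by (simp add: linear_function_set_def)

lemma linear_function_set_Int:
  "linear_function_set X W \<Longrightarrow> linear_function_set X W' \<Longrightarrow> linear_function_set X (W \<inter> W')"
  by (auto simp: linear_function_set_def)

lemma vectorspace_function_space:
  assumes "linear_function_set (carrier G) W"
  shows "vectorspace class_ring (function_space G T W)"
proof (rule vs_criteria)
  show "\<forall>v\<in>carrier (function_space G T W). \<exists>neg_v\<in>carrier (function_space G T W).
      v \<oplus>\<^bsub>function_space G T W\<^esub> neg_v = \<zero>\<^bsub>function_space G T W\<^esub>"
  proof
    fix v assume "v \<in> carrier (function_space G T W)"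
    then have "v \<in> W"
      by simp
    with assms have "(\<lambda>x\<in>carrier G. (- 1) * v x) \<in> W"
      unfolding linear_function_set_def by blast
    then show "\<exists>neg_v\<in>carrier (function_space G T W).
        v \<oplus>\<^bsub>function_space G T W\<^esub> neg_v = \<zero>\<^bsub>function_space G T W\<^esub>"
      by (intro bexI[of _ "\<lambda>x\<in>carrier G. (- 1) * v x"])
        (auto simp: continuous_functions_def fun_eq_iff)
  qed
qed (use assms class_field.field_axioms in
    \<open>auto simp: linear_function_set_def continuous_functions_def fun_eq_iff algebra_simps
       extensional_def subset_iff\<close>)

lemma subspace_function_space:
  assumes "linear_function_set (carrier G) U" "linear_function_set (carrier G) W" "W \<subseteq> U"
  shows "VectorSpace.subspace class_ring W (function_space G T U)"
proof -
  interpret vectorspace "class_ring :: complex ring" "function_space G T U"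
    by (rule vectorspace_function_space) fact
  show ?thesis
    using assms vectorspace_axioms module_axioms
    by (auto simp: VectorSpace.subspace_def submodule_def linear_function_set_def
        continuous_functions_def)
qed

lemma linear_function_set_subspace:
  assumes "VectorSpace.subspace class_ring W (function_space G T U)" "U \<subseteq> extensional (carrier G)"
  shows "linear_function_set (carrier G) W" "W \<subseteq> U"
proof -
  interpret submodule class_ring W "function_space G T U"
    using assms by (simp add: VectorSpace.subspace_def)
  have z: "(\<lambda>x\<in>carrier G. 0) \<in> W"
    using zero_closed by (simp add: continuous_functions_def)
  have a: "(\<lambda>x\<in>carrier G. f x + g x) \<in> W" if "f \<in> W" "g \<in> W" for f g
    using m_closed[OF that] by (simp add: continuous_functions_def)
  have s: "(\<lambda>x\<in>carrier G. c * f x) \<in> W" if "f \<in> W" for f c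
    using smult_closed[of c, OF _ that] by (simp add: continuous_functions_def)
  show "W \<subseteq> U"
    using subset by simp
  with assms z a s show "linear_function_set (carrier G) W"
    by (auto simp: linear_function_set_def)
qed

text \<open>A set independent in \<open>W\<close> is independent in \<open>V\<close>, hence has at
  most \<open>card A\<close> elements. So a maximal independent subset of \<open>W\<close> exists
  and is finite, and it is a basis of \<open>W\<close>.\<close>

lemma (in vectorspace) dim_subspace_le_card:
  assumes W: "VectorSpace.subspace K W V" and A: "finite A" "A \<subseteq> carrier V" "span A = carrier V"
  shows "vectorspace.dim K (vs W) \<le> card A"
proof -
  interpret W: vectorspace K "vs W"
    by (rule subspace_is_vs) fact
  have sub: "submodule K W V"
    using W by simp
  then have WV: "W \<subseteq> carrier V"
    by (rule submodule.subset)
  have fd: fin_dim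
    using A by (auto simp: fin_dim_def)
  have li: "lin_indpt S" if "S \<subseteq> W" "W.lin_indpt S" for S
    using span_li_not_depend(2)[OF that(1) sub] that(2) by simp
  have bound: "finite S \<and> card S \<le> card A" if "S \<subseteq> carrier (vs W) \<and> W.lin_indpt S" for S
  proof -
    have "S \<subseteq> carrier V" "lin_indpt S"
      using that li WV by auto
    then show ?thesis
      using li_le_dim[OF fd] gen_ge_dim[OF A] by (meson le_trans)
  qed
  have "W.lin_indpt {}"
    by (simp add: W.lin_dep_def)
  then obtain B where B: "finite B" "maximal B (\<lambda>S. S \<subseteq> carrier (vs W) \<and> W.lin_indpt S)"
    using maximal_exists[of "\<lambda>S. S \<subseteq> carrier (vs W) \<and> W.lin_indpt S" "card A" "{}"] bound
    by auto
  then have "W.dim = card B"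
    by (intro W.dim_basis W.max_li_is_basis)
  with B bound show ?thesis
    by (auto simp: maximal_def)
qed

section \<open>Functions that factor through a map with finite image\<close>

text \<open>No continuity is imposed on \<open>c\<close>, so the indicator functions of the fibres
  of \<open>r\<close> belong to the set.\<close>

definition functions_through :: "'a set \<Rightarrow> ('a \<Rightarrow> 'b) \<Rightarrow> ('a \<Rightarrow> complex) set" where
  "functions_through X r = {(\<lambda>x\<in>X. c (r x)) | c. True}"

lemma functions_throughI: "f = (\<lambda>x\<in>X. c (r x)) \<Longrightarrow> f \<in> functions_through X r"
  by (auto simp: functions_through_def)

lemma linear_function_set_functions_through: "linear_function_set X (functions_through X r)"
  unfolding linear_function_set_def
proof (intro conjI ballI allI)
  show "functions_through X r \<subseteq> extensional X"
    by (auto simp: functions_through_def)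
  show "(\<lambda>x\<in>X. 0) \<in> functions_through X r"
    by (rule functions_throughI[where c = "\<lambda>_. 0"]) simp
  fix f g assume "f \<in> functions_through X r" "g \<in> functions_through X r"
  then obtain c d where "f = (\<lambda>x\<in>X. c (r x))" "g = (\<lambda>x\<in>X. d (r x))"
    by (auto simp: functions_through_def)
  then show "(\<lambda>x\<in>X. f x + g x) \<in> functions_through X r"
    by (intro functions_throughI[where c = "\<lambda>y. c y + d y"]) auto
next
  fix f and a :: complex assume "f \<in> functions_through X r"
  then obtain c where "f = (\<lambda>x\<in>X. c (r x))"
    by (auto simp: functions_through_def)
  then show "(\<lambda>x\<in>X. a * f x) \<in> functions_through X r"
    by (intro functions_throughI[where c = "\<lambda>y. a * c y"]) auto
qed

lemma mult_functions_through:
  assumes "f \<in> functions_through X r" "g \<in> functions_through X r"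
  shows "(\<lambda>x\<in>X. f x * g x) \<in> functions_through X r"
proof -
  obtain c d where "f = (\<lambda>x\<in>X. c (r x))" "g = (\<lambda>x\<in>X. d (r x))"
    using assms by (auto simp: functions_through_def)
  then show ?thesis
    by (intro functions_throughI[where c = "\<lambda>y. c y * d y"]) auto
qed

text \<open>The indicators of the fibres of \<open>r\<close> span all functions that factor through
  \<open>r\<close>, and there are at most as many of them as values of \<open>r\<close>.\<close>

lemma dim_le_card_of_functions_through:
  fixes G :: "('a, 'b) monoid_scheme" and r :: "'a \<Rightarrow> 'c"
  assumes fin: "finite (r ` carrier G)"
    and W: "linear_function_set (carrier G) W" "W \<subseteq> functions_through (carrier G) r"
  shows "vectorspace.dim class_ring (function_space G T W) \<le> card (r ` carrier G)"
proof -
  let ?F = "functions_through (carrier G) r"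
  interpret F: vectorspace "class_ring :: complex ring" "function_space G T ?F"
    by (intro vectorspace_function_space linear_function_set_functions_through)
  define e :: "'c \<Rightarrow> 'a \<Rightarrow> complex" where
    "e y = (\<lambda>x\<in>carrier G. if r x = y then 1 else 0)" for y
  let ?E = "e ` r ` carrier G"
  have E: "?E \<subseteq> carrier (function_space G T ?F)"
    unfolding e_def functions_through_def by force
  have span: "linear_function_set (carrier G) (F.span ?E)"
    by (rule linear_function_set_subspace(1)[OF F.span_is_subspace[OF E]])
      (auto simp: functions_through_def)
  \<comment> \<open>Induction on the set \<open>Y\<close> of values already treated: each new value
    \<open>y\<close> contributes the multiple \<open>c y\<close> of its fibre indicator. Taking
    \<open>Y\<close> to be the whole image recovers an arbitrary function.\<close>
  have gen: "(\<lambda>x\<in>carrier G. if r x \<in> Y then c (r x) else 0) \<in> F.span ?E"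
    if "finite Y" "Y \<subseteq> r ` carrier G" for Y c
    using that
  proof (induction Y)
    case empty
    show ?case
      using span by (simp only: linear_function_set_def empty_iff if_False)
  next
    case (insert y Y)
    let ?f = "\<lambda>x\<in>carrier G. if r x \<in> Y then c (r x) else 0" and ?g = "\<lambda>x\<in>carrier G. c y * e y x"
    have "e y \<in> F.span ?E"
      using F.in_own_span[OF E] insert.prems by auto
    then have "?g \<in> F.span ?E"
      using span by (simp add: linear_function_set_def)
    moreover have "?f \<in> F.span ?E"
      using insert.IH insert.prems by blast
    ultimately have "(\<lambda>x\<in>carrier G. ?f x + ?g x) \<in> F.span ?E"
      by (intro linear_function_set_add[OF span])
    moreover have "(\<lambda>x\<in>carrier G. ?f x + ?g x) =
        (\<lambda>x\<in>carrier G. if r x \<in> insert y Y then c (r x) else 0)"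
      using insert.hyps by (auto simp: e_def fun_eq_iff)
    ultimately show ?case
      by (simp only:)
  qed
  have "?F \<subseteq> F.span ?E"
  proof
    fix f assume "f \<in> ?F"
    then obtain c where "f = (\<lambda>x\<in>carrier G. c (r x))"
      by (auto simp: functions_through_def)
    then have "f = (\<lambda>x\<in>carrier G. if r x \<in> r ` carrier G then c (r x) else 0)"
      by (auto simp: fun_eq_iff)
    with gen[OF fin subset_refl] show "f \<in> F.span ?E"
      by simp
  qed
  then have "F.span ?E = carrier (function_space G T ?F)"
    using F.span_is_subset2[OF E] by auto
  moreover have "VectorSpace.subspace class_ring W (function_space G T ?F)"
    by (intro subspace_function_space linear_function_set_functions_through W)
  ultimately have "vectorspace.dim class_ring (function_space G T ?F\<lparr>carrier := W\<rparr>) \<le> card ?E"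
    using F.dim_subspace_le_card fin E by blast
  also have "\<dots> \<le> card (r ` carrier G)"
    by (rule card_image_le) fact
  finally show ?thesis
    by simp
qed

section \<open>Two estimates: bounded growth, and matrices near the identity\<close>

text \<open>The numerator stays between 0 and a constant while \<open>ln n\<close> tends to
  infinity.\<close>

lemma limsup_ln_bounded_over_ln:
  fixes d :: "nat \<Rightarrow> nat"
  assumes "\<And>n. d n \<le> D"
  shows "limsup (\<lambda>n. ereal (ln (real (d n)) / ln (real n))) = 0"
proof -
  \<comment> \<open>The convention \<open>ln 0 = 0\<close> covers \<open>m = 0\<close>, so the
    quotients are nonnegative for every \<open>n\<close>, including the degenerate indices 0 and
    1.\<close>
  have ln_nonneg: "0 \<le> ln (real m)" for m
    by (cases "m = 0") auto
  have "filterlim (\<lambda>n. ln (real n)) at_top sequentially"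
    by (rule filterlim_compose[OF ln_at_top filterlim_real_sequentially])
  then have lim: "(\<lambda>n. ln (real (Suc D)) / ln (real n)) \<longlonglongrightarrow> 0"
    by (intro tendsto_divide_0[OF tendsto_const] filterlim_at_top_imp_at_infinity)
  have "ln (real (d n)) \<le> ln (real (Suc D))" for n
    using assms[of n] ln_nonneg[of "Suc D"] by (cases "d n = 0") auto
  then have "(\<lambda>n. ln (real (d n)) / ln (real n)) \<longlonglongrightarrow> 0"
    by (intro tendsto_sandwich[OF _ _ tendsto_const lim] always_eventually allI
        divide_nonneg_nonneg divide_right_mono ln_nonneg)
  then have "(\<lambda>n. ereal (ln (real (d n)) / ln (real n))) \<longlonglongrightarrow> ereal 0"
    by simp
  then show ?thesis
    by (simp add: lim_imp_Limsup zero_ereal_def)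
qed

text \<open>With \<open>E = A - 1\<close>, the identity \<open>2E = (A\<^sup>2 - 1) - E\<^sup>2\<close> turns a bound \<open>b\<close> on the entries of
  \<open>B - 1\<close> for all \<open>B\<close> in \<open>H\<close> into the bound \<open>(1 + d\<epsilon>) b / 2 \<le> 3b / 4\<close>.\<close>
lemma matrix_semigroup_near_one_trivial:
  fixes H :: "complex mat set"
  assumes H: "H \<subseteq> carrier_mat d d" "\<And>A. A \<in> H \<Longrightarrow> A * A \<in> H"
    and near: "\<And>A i j. A \<in> H \<Longrightarrow> i < d \<Longrightarrow> j < d \<Longrightarrow> norm ((A - 1\<^sub>m d) $$ (i, j)) \<le> \<epsilon>"
    and small: "real d * \<epsilon> \<le> 1 / 2" and "A \<in> H"
  shows "A = 1\<^sub>m d"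
proof -
  \<comment> \<open>The bound must hold for all members of \<open>H\<close> at once, since the
    induction step for \<open>A\<close> uses the hypothesis for \<open>A * A\<close>.\<close>
  have decay: "norm ((A - 1\<^sub>m d) $$ (i, j)) \<le> \<epsilon> * (3 / 4) ^ k"
    if "A \<in> H" "i < d" "j < d" for A i j k
    using that
  proof (induction k arbitrary: A i j)
    case 0
    then show ?case
      using near by simp
  next
    case (Suc k)
    let ?b = "\<epsilon> * (3 / 4) ^ k" and ?E = "A - 1\<^sub>m d"
    have A: "A \<in> carrier_mat d d" and AA: "A * A \<in> H"
      using Suc.prems H by auto
    have eps: "0 \<le> \<epsilon>"
      using near[OF Suc.prems] norm_ge_zero order_trans by blast
    have "?E * ?E = A * ?E - 1\<^sub>m d * ?E"
      using A by (intro minus_mult_distrib_mat) auto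
    also have "\<dots> = (A * A - A) - ?E"
      using A by (simp add: mult_minus_distrib_mat[of A d d A d "1\<^sub>m d"])
    finally have sq: "(?E * ?E) $$ (i, j) = (A * A) $$ (i, j) - A $$ (i, j) - ?E $$ (i, j)"
      using A Suc.prems by simp
    have "(?E * ?E) $$ (i, j) = (\<Sum>l<d. ?E $$ (i, l) * ?E $$ (l, j))"
      using A Suc.prems by (auto simp: scalar_prod_def lessThan_atLeast0 intro!: sum.cong)
    with sq A Suc.prems
    have "2 * ?E $$ (i, j) = (A * A - 1\<^sub>m d) $$ (i, j) - (\<Sum>l<d. ?E $$ (i, l) * ?E $$ (l, j))"
      by simp
    then have "2 * norm (?E $$ (i, j)) =
        norm ((A * A - 1\<^sub>m d) $$ (i, j) - (\<Sum>l<d. ?E $$ (i, l) * ?E $$ (l, j)))"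
      by (metis norm_mult norm_numeral)
    also have "\<dots> \<le> norm ((A * A - 1\<^sub>m d) $$ (i, j)) + (\<Sum>l<d. norm (?E $$ (i, l) * ?E $$ (l, j)))"
      by (rule order_trans[OF norm_triangle_ineq4]) (intro add_mono order_refl norm_sum)
    \<comment> \<open>In each product one factor is bounded by the fixed \<open>\<epsilon>\<close>
      and the other by the induction hypothesis. The sum therefore contributes
      \<open>d * \<epsilon>\<close> times the current bound, at most half of it.\<close>
    also have "\<dots> \<le> ?b + (\<Sum>l<d. \<epsilon> * ?b)"
      using Suc.prems eps near Suc.IH AA unfolding norm_mult
      by (intro add_mono sum_mono mult_mono) auto
    also have "\<dots> = ?b + real d * \<epsilon> * ?b"
      by simp
    also have "\<dots> \<le> ?b + 1 / 2 * ?b"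
      using eps by (intro add_left_mono mult_right_mono small) auto
    finally show ?case
      by simp
  qed
  show ?thesis
  proof (rule eq_matI)
    fix i j assume ij: "i < dim_row (1\<^sub>m d :: complex mat)" "j < dim_col (1\<^sub>m d :: complex mat)"
    have "(\<lambda>k. \<epsilon> * (3 / 4) ^ k) \<longlonglongrightarrow> \<epsilon> * 0"
      by (intro tendsto_mult tendsto_const LIMSEQ_realpow_zero) auto
    then have "norm ((A - 1\<^sub>m d) $$ (i, j)) \<le> \<epsilon> * 0"
      by (rule LIMSEQ_le_const) (use decay \<open>A \<in> H\<close> ij in auto)
    then show "A $$ (i, j) = 1\<^sub>m d $$ (i, j)"
      using ij H(1) \<open>A \<in> H\<close> by auto
  qed (use H(1) \<open>A \<in> H\<close> in auto)
qed


section \<open>Powers and generators of finite-dimensional function spaces\<close>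

text \<open>\<open>W\<close> is a unital subalgebra containing \<open>V\<close>, so it contains
  every product of elements of \<open>V\<close>, the empty one included, and then their
  span.\<close>

lemma power_filtration_subset:
  assumes R: "linear_function_set (carrier G) R" and W: "linear_function_set (carrier G) W"
    and one: "(\<lambda>x\<in>carrier G. 1) \<in> W"
    and mult: "\<forall>f\<in>W. \<forall>g\<in>W. (\<lambda>x\<in>carrier G. f x * g x) \<in> W"
    and V: "V \<subseteq> W" and WR: "W \<subseteq> R"
  shows "power_filtration class_ring (function_space G T R) V n \<subseteq> W"
    and "linear_function_set (carrier G) (power_filtration class_ring (function_space G T R) V n)"
proof -
  let ?A = "function_space G T R"
  interpret vectorspace "class_ring :: complex ring" ?A
    by (rule vectorspace_function_space) fact
  let ?S = "{foldr (mult ?A) vs \<one>\<^bsub>?A\<^esub> | vs. set vs \<subseteq> V \<and> length vs \<le> n}"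
  have "foldr (mult ?A) vs \<one>\<^bsub>?A\<^esub> \<in> W" if "set vs \<subseteq> V" for vs
    using that V one mult by (induction vs) (auto simp: continuous_functions_def)
  then have S: "?S \<subseteq> W"
    by auto
  have "submodule class_ring W ?A"
    using subspace_function_space[OF R W WR] by simp
  with S show "power_filtration class_ring ?A V n \<subseteq> W"
    unfolding power_filtration_def by (rule span_is_subset)
  have "VectorSpace.subspace class_ring (power_filtration class_ring ?A V n) ?A"
    unfolding power_filtration_def by (rule span_is_subspace) (use S WR in auto)
  then show "linear_function_set (carrier G) (power_filtration class_ring ?A V n)"
    by (rule linear_function_set_subspace) (use R in \<open>simp add: linear_function_set_def\<close>)
qed

text \<open>Generation is phrased against arbitrary linear sets \<open>W\<close>, which need not lie
  in \<open>V\<close>. It holds because \<open>V \<inter> W\<close> is a subspace of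
  \<open>V\<close> containing the generators.\<close>

lemma fin_dim_function_space_generators:
  assumes V: "linear_function_set (carrier G) V"
    and fd: "vectorspace.fin_dim class_ring (function_space G T V)"
  obtains A where "finite A" "A \<subseteq> V"
    "\<forall>W. linear_function_set (carrier G) W \<longrightarrow> A \<subseteq> W \<longrightarrow> V \<subseteq> W"
proof -
  interpret vectorspace "class_ring :: complex ring" "function_space G T V"
    by (rule vectorspace_function_space) fact
  obtain A where A: "finite A" "A \<subseteq> V" "span A = V"
    using fd by (auto simp: fin_dim_def)
  have "V \<subseteq> W" if W: "linear_function_set (carrier G) W" "A \<subseteq> W" for W
  proof -
    have "VectorSpace.subspace class_ring (V \<inter> W) (function_space G T V)"
      by (intro subspace_function_space linear_function_set_Int V W) auto
    then have "span A \<subseteq> V \<inter> W"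
      using A W by (intro span_is_subset) auto
    with A show ?thesis
      by simp
  qed
  with A show thesis
    using that by blast
qed

text \<open>This provides a member of the family over which the supremum in \<open>GKdim\<close> is
  taken.\<close>

lemma fin_dim_zero_function_space:
  "vectorspace.fin_dim class_ring (function_space G T {\<lambda>x\<in>carrier G. 0})"
proof -
  have "linear_function_set (carrier G) {\<lambda>x\<in>carrier G. 0}"
    by (auto simp: linear_function_set_def fun_eq_iff)
  then interpret vectorspace "class_ring :: complex ring" "function_space G T {\<lambda>x\<in>carrier G. 0}"
    by (rule vectorspace_function_space)
  have "span {\<lambda>x\<in>carrier G. 0} = {\<lambda>x\<in>carrier G. 0}"
    using span_is_subset2[of "{\<lambda>x\<in>carrier G. 0}"] in_own_span[of "{\<lambda>x\<in>carrier G. 0}"] by auto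
  then show ?thesis
    unfolding fin_dim_def by (intro exI[of _ "{\<lambda>x\<in>carrier G. 0}"]) simp
qed

section \<open>Right-invariant continuous functions and the algebra O(G)\<close>

context topological_group
begin

text \<open>For a subgroup \<open>H\<close> these are the continuous functions constant on the left
  cosets of \<open>H\<close>.\<close>

definition right_invariant_functions :: "'a set \<Rightarrow> ('a \<Rightarrow> complex) set" where
  "right_invariant_functions H =
     {f \<in> carrier (continuous_functions G T). \<forall>x\<in>carrier G. \<forall>h\<in>H. f (x \<otimes> h) = f x}"

lemma right_invariant_functions_antimono:
  "H \<subseteq> K \<Longrightarrow> right_invariant_functions K \<subseteq> right_invariant_functions H"
  by (auto simp: right_invariant_functions_def)

lemma continuous_functions_iff:
  "f \<in> carrier (continuous_functions G T) \<longleftrightarrow>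
     f \<in> extensional (carrier G) \<and> continuous_map T euclidean f"
  by (simp add: continuous_functions_def)

lemma continuous_functions_restrictI:
  assumes "continuous_map T euclidean f"
  shows "(\<lambda>x\<in>carrier G. f x) \<in> carrier (continuous_functions G T)"
  using continuous_map_eq[OF assms, of "\<lambda>x\<in>carrier G. f x"]
  by (simp add: continuous_functions_iff topspace_eq)

lemma continuous_functions_add:
  assumes "f \<in> carrier (continuous_functions G T)" "g \<in> carrier (continuous_functions G T)"
  shows "(\<lambda>x\<in>carrier G. f x + g x) \<in> carrier (continuous_functions G T)"
  using assms by (intro continuous_functions_restrictI continuous_map_add)
    (auto simp: continuous_functions_iff)

lemma continuous_functions_mult:
  assumes "f \<in> carrier (continuous_functions G T)" "g \<in> carrier (continuous_functions G T)"
  shows "(\<lambda>x\<in>carrier G. f x * g x) \<in> carrier (continuous_functions G T)"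
  using assms by (intro continuous_functions_restrictI)
    (auto simp: continuous_functions_iff continuous_map_atin intro!: tendsto_mult)

lemma continuous_functions_const: "(\<lambda>x\<in>carrier G. c) \<in> carrier (continuous_functions G T)"
  by (intro continuous_functions_restrictI) simp

lemma continuous_functions_cmult:
  assumes "f \<in> carrier (continuous_functions G T)"
  shows "(\<lambda>x\<in>carrier G. c * f x) \<in> carrier (continuous_functions G T)"
  using assms by (intro continuous_functions_restrictI)
    (auto simp: continuous_functions_iff continuous_map_atin intro!: tendsto_mult)

lemma continuous_functions_cnj:
  assumes "f \<in> carrier (continuous_functions G T)"
  shows "(\<lambda>x\<in>carrier G. cnj (f x)) \<in> carrier (continuous_functions G T)"
  using assms by (intro continuous_functions_restrictI)
    (auto simp: continuous_functions_iff continuous_map_atin intro!: tendsto_cnj)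

lemma linear_function_set_continuous_functions:
  "linear_function_set (carrier G) (carrier (continuous_functions G T))"
  using continuous_functions_add continuous_functions_cmult continuous_functions_const
  by (auto simp: linear_function_set_def continuous_functions_iff)

lemma function_space_continuous_functions:
  "function_space G T (carrier (continuous_functions G T)) = continuous_functions G T"
  by simp

text \<open>Shrinking the subgroup enlarges the set of invariant functions, so the union is
  increasing. Any two members share a level, and pointwise operations preserve invariance
  there.\<close>

lemma star_subalgebra_right_invariant_functions:
  fixes N :: "nat \<Rightarrow> 'a set"
  assumes N: "antimono N" "\<And>n. N n \<subseteq> carrier G"
  shows "star_subalgebra G T (\<Union>n. right_invariant_functions (N n))"
proof -
  let ?L = "\<lambda>n. right_invariant_functions (N n)"
  let ?B = "\<Union>n. ?L n"
  have common: "\<exists>n. f \<in> right_invariant_functions (N n) \<and> g \<in> right_invariant_functions (N n)"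
    if fg: "f \<in> ?B" "g \<in> ?B" for f g
  proof -
    obtain m n where "f \<in> right_invariant_functions (N m)" "g \<in> right_invariant_functions (N n)"
      using fg by blast
    moreover have "N (max m n) \<subseteq> N m" "N (max m n) \<subseteq> N n"
      using antimonoD[OF N(1)] by auto
    ultimately show ?thesis
      using right_invariant_functions_antimono by (meson subsetD)
  qed
  have closed: "x \<otimes> h \<in> carrier G" if "x \<in> carrier G" "h \<in> N n" for x h n
    using that N(2) by blast
  have const: "(\<lambda>x\<in>carrier G. c) \<in> ?B" for c
    using closed by (auto simp: right_invariant_functions_def continuous_functions_const)
  have add: "(\<lambda>x\<in>carrier G. f x + g x) \<in> ?B" if fg: "f \<in> ?B" "g \<in> ?B" for f g
  proof -
    obtain n where "f \<in> ?L n" "g \<in> ?L n"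
      using common[OF fg] by blast
    then have "(\<lambda>x\<in>carrier G. f x + g x) \<in> ?L n"
      using closed by (auto simp: right_invariant_functions_def continuous_functions_add)
    then show ?thesis
      by blast
  qed
  have mult: "(\<lambda>x\<in>carrier G. f x * g x) \<in> ?B" if fg: "f \<in> ?B" "g \<in> ?B" for f g
  proof -
    obtain n where "f \<in> ?L n" "g \<in> ?L n"
      using common[OF fg] by blast
    then have "(\<lambda>x\<in>carrier G. f x * g x) \<in> ?L n"
      using closed by (auto simp: right_invariant_functions_def continuous_functions_mult)
    then show ?thesis
      by blast
  qed
  have cmult: "(\<lambda>x\<in>carrier G. c * f x) \<in> ?B" if "f \<in> ?B" for f c
    using that closed by (auto simp: right_invariant_functions_def continuous_functions_cmult)
  have cnj: "(\<lambda>x\<in>carrier G. cnj (f x)) \<in> ?B" if "f \<in> ?B" for f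
    using that closed by (auto simp: right_invariant_functions_def continuous_functions_cnj)
  have sub: "?B \<subseteq> carrier (continuous_functions G T)"
    by (auto simp: right_invariant_functions_def)
  then have "linear_function_set (carrier G) ?B"
    using const[of 0] add cmult unfolding linear_function_set_def
    by (auto simp: continuous_functions_iff)
  then have "VectorSpace.subspace class_ring ?B (continuous_functions G T)"
    using subspace_function_space[OF linear_function_set_continuous_functions _ sub, where T = T]
    by (simp only: function_space_continuous_functions)
  then show ?thesis
    unfolding star_subalgebra_def using const[of 1] mult cnj
    by (simp add: continuous_functions_def)
qed

text \<open>All the closure properties pass to intersections. The given \<open>B\<close> makes the
  family nonempty, which keeps the intersection inside the extensional functions.\<close>

lemma representative_functions_algebra:
  assumes "star_subalgebra G T B" "matrix_entries G T \<subseteq> B"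
  obtains R where "representative_functions G T = function_space G T R" "R \<subseteq> B"
    "linear_function_set (carrier G) R" "(\<lambda>x\<in>carrier G. 1) \<in> R"
    "\<forall>f\<in>R. \<forall>g\<in>R. (\<lambda>x\<in>carrier G. f x * g x) \<in> R"
proof
  let ?R = "\<Inter>{B. star_subalgebra G T B \<and> matrix_entries G T \<subseteq> B}"
  show "representative_functions G T = function_space G T ?R"
    by (simp add: representative_functions_def)
  show "?R \<subseteq> B"
    using assms by auto
  have lin: "linear_function_set (carrier G) B'" if "star_subalgebra G T B'" for B'
    using that linear_function_set_continuous_functions
    by (intro linear_function_set_subspace(1)[where U = "carrier (continuous_functions G T)" and T = T])
      (auto simp: star_subalgebra_def linear_function_set_def)
  show "linear_function_set (carrier G) ?R"
    using lin[OF assms(1)] lin assms unfolding linear_function_set_def by blast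
  show "(\<lambda>x\<in>carrier G. 1) \<in> ?R"
    by (auto simp: star_subalgebra_def continuous_functions_def)
  show "\<forall>f\<in>?R. \<forall>g\<in>?R. (\<lambda>x\<in>carrier G. f x * g x) \<in> ?R"
    by (auto simp: star_subalgebra_def continuous_functions_def)
qed

section \<open>Representations are trivial on small subgroups\<close>

text \<open>A no-small-subgroups argument: by continuity some \<open>N n\<close> is mapped near the
  identity matrix, and its image is closed under squaring, so
  \<open>matrix_semigroup_near_one_trivial\<close> applies.\<close>

lemma unitary_rep_trivial_on_open_subgroup:
  assumes rep: "unitary_rep G T d \<pi>"
    and basis: "\<And>U. openin T U \<Longrightarrow> \<one> \<in> U \<Longrightarrow> \<exists>n. N n \<subseteq> U"
    and N: "\<And>n. subgroup (N n) G"
  obtains n where "\<And>x. x \<in> N n \<Longrightarrow> \<pi> x = 1\<^sub>m d"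
proof -
  have dim: "\<pi> x \<in> carrier_mat d d"
    and unitary: "mat_adjoint (\<pi> x) * \<pi> x = 1\<^sub>m d" if "x \<in> carrier G" for x
    using rep that by (auto simp: unitary_rep_def unitary_group_def hom_def Pi_iff)
  have mult: "\<pi> (x \<otimes> y) = \<pi> x * \<pi> y" if "x \<in> carrier G" "y \<in> carrier G" for x y
    using rep that by (auto simp: unitary_rep_def unitary_group_def hom_def)
  have cont: "continuous_map T euclidean (\<lambda>x. \<pi> x $$ (i, j))" if "i < d" "j < d" for i j
    using rep that by (auto simp: unitary_rep_def)
  \<comment> \<open>The matrix at the identity is idempotent; multiplying by its adjoint, a left
    inverse, cancels one factor.\<close>
  have one: "\<pi> \<one> = 1\<^sub>m d"
  proof -
    have adj: "mat_adjoint (\<pi> \<one>) \<in> carrier_mat d d"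
      using dim[OF one_closed] by (auto simp: mat_adjoint_def)
    have "\<pi> \<one> = mat_adjoint (\<pi> \<one>) * \<pi> \<one> * \<pi> \<one>"
      using unitary[OF one_closed] dim[OF one_closed] by simp
    also have "\<dots> = mat_adjoint (\<pi> \<one>) * \<pi> \<one>"
      using mult[of \<one> \<one>] dim[OF one_closed] adj assoc_mult_mat[OF adj dim dim] by simp
    finally show ?thesis
      using unitary by simp
  qed
  \<comment> \<open>\<open>Suc d\<close> in the denominator keeps the radius positive when
    \<open>d = 0\<close>.\<close>
  define \<epsilon> :: real where "\<epsilon> = 1 / (2 * real (Suc d))"
  have eps: "0 < \<epsilon>" "real d * \<epsilon> \<le> 1 / 2"
    by (auto simp: \<epsilon>_def divide_simps)
  define B where "B p = {x \<in> topspace T. \<pi> x $$ p \<in> ball (1\<^sub>m d $$ p) \<epsilon>}" for p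
  \<comment> \<open>Intersecting with \<open>topspace T\<close> keeps \<open>U\<close> open also
    when \<open>d = 0\<close> and the family of conditions is empty.\<close>
  define U where "U = topspace T \<inter> \<Inter>(B ` ({..<d} \<times> {..<d}))"
  have "openin T (B p)" if "p \<in> {..<d} \<times> {..<d}" for p
    unfolding B_def using cont that by (intro openin_continuous_map_preimage) auto
  then have "openin T U"
    unfolding U_def by (intro openin_Int_Inter) auto
  moreover have "\<one> \<in> U"
    using eps by (auto simp: U_def B_def one topspace_eq)
  ultimately obtain n where n: "N n \<subseteq> U"
    using basis by blast
  have "\<pi> x = 1\<^sub>m d" if "x \<in> N n" for x
  proof (rule matrix_semigroup_near_one_trivial[where H = "\<pi> ` N n"])
    show "\<pi> ` N n \<subseteq> carrier_mat d d"
      using dim subgroup.subset[OF N] by blast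
    show "A * A \<in> \<pi> ` N n" if A: "A \<in> \<pi> ` N n" for A
    proof -
      obtain y where y: "y \<in> N n" "A = \<pi> y"
        using A by blast
      then have "y \<otimes> y \<in> N n" "y \<in> carrier G"
        using subgroup.m_closed[OF N] subgroup.mem_carrier[OF N] by blast+
      with y show ?thesis
        by (auto simp: mult[symmetric])
    qed
    show "norm ((A - 1\<^sub>m d) $$ (i, j)) \<le> \<epsilon>" if A: "A \<in> \<pi> ` N n" and ij: "i < d" "j < d" for A i j
    proof -
      obtain y where y: "y \<in> U" "A = \<pi> y"
        using A n by blast
      with ij have "\<pi> y $$ (i, j) \<in> ball (1\<^sub>m d $$ (i, j)) \<epsilon>"
        unfolding U_def B_def by blast
      then show ?thesis
        using y ij by (simp add: dist_norm norm_minus_commute)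
    qed
  qed (use that eps in auto)
  then show thesis
    using that by blast
qed

text \<open>Where \<open>\<pi> h\<close> is the identity matrix,
  \<open>\<pi> (x \<otimes> h) = \<pi> x * \<pi> h = \<pi> x\<close>, entry by entry.\<close>

lemma matrix_entries_right_invariant:
  assumes basis: "\<And>U. openin T U \<Longrightarrow> \<one> \<in> U \<Longrightarrow> \<exists>n. N n \<subseteq> U"
    and N: "\<And>n. subgroup (N n) G"
  shows "matrix_entries G T \<subseteq> (\<Union>n. right_invariant_functions (N n))"
proof
  fix f assume "f \<in> matrix_entries G T"
  then obtain \<pi> d i j where f: "f = (\<lambda>x\<in>carrier G. \<pi> x $$ (i, j))" "i < d" "j < d"
    and rep: "unitary_rep G T d \<pi>"
    by (auto simp: matrix_entries_def irreducible_unitary_rep_def)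
  obtain n where n: "\<And>x. x \<in> N n \<Longrightarrow> \<pi> x = 1\<^sub>m d"
    using unitary_rep_trivial_on_open_subgroup[OF rep basis N] by blast
  have "f (x \<otimes> h) = f x" if "x \<in> carrier G" "h \<in> N n" for x h
  proof -
    have "h \<in> carrier G"
      using that subgroup.mem_carrier[OF N] by blast
    moreover have "\<pi> x \<in> carrier_mat d d" "\<pi> (x \<otimes> h) = \<pi> x * \<pi> h"
      using rep that \<open>h \<in> carrier G\<close>
      by (auto simp: unitary_rep_def unitary_group_def hom_def Pi_iff)
    ultimately show ?thesis
      using that f by (simp add: n)
  qed
  moreover have "f \<in> carrier (continuous_functions G T)"
    unfolding f(1) using rep f by (intro continuous_functions_restrictI) (auto simp: unitary_rep_def)
  ultimately show "f \<in> (\<Union>n. right_invariant_functions (N n))"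
    by (auto simp: right_invariant_functions_def)
qed

section \<open>Finitely many cosets by compactness\<close>

text \<open>The left cosets of \<open>H\<close> form an open cover, so finitely many suffice. The
  map \<open>r\<close> picks for each point a representative of its coset from a finite set.\<close>

lemma right_invariant_functions_through_finite:
  assumes compact: "compactin T (carrier G)" and H: "openin T H" "subgroup H G"
  obtains r :: "'a \<Rightarrow> 'a" where "finite (r ` carrier G)"
    "right_invariant_functions H \<subseteq> functions_through (carrier G) r"
proof -
  \<comment> \<open>This is the left coset of \<open>x\<close>, written as the preimage of
    \<open>H\<close> under translation by \<open>inv x\<close> so that continuity of the
    multiplication makes it open.\<close>
  define C where "C x = {y \<in> topspace T. inv x \<otimes> y \<in> H}" for x
  have C_open: "openin T (C x)" if "x \<in> carrier G" for x
  proof -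
    have "continuous_map T (prod_topology T T) (\<lambda>y. (inv x, y))"
      using that by (intro continuous_map_pairedI) (auto simp: topspace_eq)
    from continuous_map_compose[OF this continuous_mult]
    have "continuous_map T T (\<lambda>y. inv x \<otimes> y)"
      by (simp add: o_def)
    then show ?thesis
      unfolding C_def using H(1) by (rule openin_continuous_map_preimage)
  qed
  have self: "x \<in> C x" if "x \<in> carrier G" for x
    using that subgroup.one_closed[OF H(2)] by (simp add: C_def topspace_eq)
  have "\<exists>\<F>. finite \<F> \<and> \<F> \<subseteq> C ` carrier G \<and> carrier G \<subseteq> \<Union>\<F>"
    by (rule compactinD[OF compact]) (use C_open self in auto)
  then obtain X where X: "finite X" "X \<subseteq> carrier G" "carrier G \<subseteq> (\<Union>x\<in>X. C x)"
    by (metis finite_subset_image)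
  then obtain r where r: "\<And>y. y \<in> carrier G \<Longrightarrow> r y \<in> X \<and> y \<in> C (r y)"
    by (metis UN_E subsetD)
  have "f \<in> functions_through (carrier G) r" if f: "f \<in> right_invariant_functions H" for f
  proof (rule functions_throughI)
    \<comment> \<open>The point \<open>y\<close> is \<open>r y\<close> times the element
      \<open>inv (r y) \<otimes> y\<close> of \<open>H\<close>.\<close>
    have "f y = f (r y)" if y: "y \<in> carrier G" for y
    proof -
      have ry: "r y \<in> carrier G" "inv (r y) \<otimes> y \<in> H"
        using r[OF y] X by (auto simp: C_def)
      then have "f (r y \<otimes> (inv (r y) \<otimes> y)) = f (r y)"
        using f by (simp add: right_invariant_functions_def)
      with y ry show ?thesis
        by (simp add: m_assoc[symmetric])
    qed
    moreover have "f \<in> extensional (carrier G)"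
      using f by (simp add: right_invariant_functions_def continuous_functions_iff)
    ultimately show "f = (\<lambda>x\<in>carrier G. f (r x))"
      by (auto simp: fun_eq_iff extensional_def)
  qed
  moreover have "finite (r ` carrier G)"
    using r X by (meson finite_subset image_subsetI)
  ultimately show thesis
    using that by blast
qed

end

section \<open>Bounded growth in O(G)\<close>

lemma finite_subset_UN_mono:
  fixes L :: "nat \<Rightarrow> 'a set"
  assumes "mono L" "finite A" "A \<subseteq> (\<Union>n. L n)"
  obtains n where "A \<subseteq> L n"
proof -
  have "\<exists>n. A \<subseteq> L n"
    using assms(2,3)
  proof (induction A)
    case (insert a A)
    then obtain m n where "a \<in> L m" "A \<subseteq> L n"
      by auto
    moreover have "L m \<subseteq> L (max m n)" "L n \<subseteq> L (max m n)"
      using monoD[OF assms(1)] by auto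
    ultimately show ?case
      by blast
  qed simp
  with that show thesis
    by blast
qed

theorem theorem3p12:
  fixes G :: "('a, 'b) monoid_scheme" and T :: "'a topology"
  assumes "compact_vilenkin_group G T"
  shows "GKdim (class_ring :: complex ring) (representative_functions G T) = 0"
proof -
  interpret compact_vilenkin_group G T
    by fact
  obtain N :: "nat \<Rightarrow> 'a set" where N0: "N 0 = carrier G" and dec: "\<forall>n. N (Suc n) \<subset> N n"
    and N_all: "\<forall>n. compactin T (N n) \<and> openin T (N n) \<and> N n \<lhd> G"
    and basis_all: "\<forall>U. openin T U \<and> \<one>\<^bsub>G\<^esub> \<in> U \<longrightarrow> (\<exists>n. N n \<subseteq> U)"
    using filtration by (elim exE conjE) (rule that)
  have N: "compactin T (N n)" "openin T (N n)" "N n \<lhd> G" for n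
    using N_all by auto
  have basis: "\<exists>n. N n \<subseteq> U" if "openin T U" "\<one>\<^bsub>G\<^esub> \<in> U" for U
    using basis_all that by blast
  have anti: "antimono N"
    using dec by (auto intro: decseq_SucI)
  have sub: "subgroup (N n) G" for n
    using N(3) by (rule normal_imp_subgroup)
  let ?L = "\<lambda>n. right_invariant_functions (N n)"
  have monoL: "mono ?L"
    using antimonoD[OF anti] by (intro monoI right_invariant_functions_antimono)
  have "star_subalgebra G T (\<Union>n. ?L n)"
    using subgroup.subset[OF sub] by (rule star_subalgebra_right_invariant_functions[OF anti])
  moreover have "matrix_entries G T \<subseteq> (\<Union>n. ?L n)"
    by (rule matrix_entries_right_invariant[OF basis sub])
  ultimately obtain R where R: "representative_functions G T = function_space G T R" "R \<subseteq> (\<Union>n. ?L n)"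
      "linear_function_set (carrier G) R" "(\<lambda>x\<in>carrier G. 1) \<in> R"
      "\<forall>f\<in>R. \<forall>g\<in>R. (\<lambda>x\<in>carrier G. f x * g x) \<in> R"
    by (rule representative_functions_algebra) (rule that)
  let ?A = "function_space G T R"
  let ?growth = "\<lambda>V n. ereal (ln (real (vectorspace.dim class_ring
    (function_space G T (power_filtration class_ring ?A V n)))) / ln (real n))"
  let ?\<V> = "{V. VectorSpace.subspace class_ring V ?A \<and> vectorspace.fin_dim class_ring (function_space G T V)}"
  have growth: "limsup (?growth V) = 0" if V_in: "V \<in> ?\<V>" for V
  proof -
    have ext: "R \<subseteq> extensional (carrier G)"
      using R(3) by (simp add: linear_function_set_def)
    have "VectorSpace.subspace class_ring V ?A"
      and fd: "vectorspace.fin_dim class_ring (function_space G T V)"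
      using V_in by auto
    note V = linear_function_set_subspace[OF this(1) ext]
    obtain B where B: "finite B" "B \<subseteq> V"
      and gen: "\<forall>W. linear_function_set (carrier G) W \<longrightarrow> B \<subseteq> W \<longrightarrow> V \<subseteq> W"
      by (rule fin_dim_function_space_generators[OF V(1) fd]) (rule that)
    then have "B \<subseteq> (\<Union>n. ?L n)"
      using V(2) R(2) by blast
    then obtain m where m: "B \<subseteq> ?L m"
      by (rule finite_subset_UN_mono[OF monoL B(1)])
    \<comment> \<open>The group is compact because it is the member \<open>N 0\<close> of the
      filtration.\<close>
    obtain r :: "'a \<Rightarrow> 'a" where r: "finite (r ` carrier G)"
      "?L m \<subseteq> functions_through (carrier G) r"
      by (rule right_invariant_functions_through_finite[OF N(1)[of 0, unfolded N0] N(2) sub])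
    let ?F = "functions_through (carrier G) r"
    \<comment> \<open>Only the finitely many generators were placed at level \<open>m\<close>;
      linearity of \<open>?F\<close> carries the inclusion over to all of \<open>V\<close>.\<close>
    have "V \<subseteq> ?F"
      using m r gen linear_function_set_functions_through by (meson order_trans)
    have one: "(\<lambda>x\<in>carrier G. 1) \<in> ?F"
      by (rule functions_throughI[where c = "\<lambda>_. 1"]) simp
    \<comment> \<open>Powers of \<open>V\<close> are formed inside \<open>R\<close>, while the
      dimension bound comes from \<open>?F\<close>. The intersection is a unital subalgebra of
      \<open>R\<close> that also satisfies the bound.\<close>
    have lin: "linear_function_set (carrier G) (R \<inter> ?F)"
      by (intro linear_function_set_Int linear_function_set_functions_through R)
    have unit: "(\<lambda>x\<in>carrier G. 1) \<in> R \<inter> ?F"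
      using R(4) one by simp
    have mult: "\<forall>f\<in>R \<inter> ?F. \<forall>g\<in>R \<inter> ?F. (\<lambda>x\<in>carrier G. f x * g x) \<in> R \<inter> ?F"
      using R(5) by (blast intro: mult_functions_through)
    have "V \<subseteq> R \<inter> ?F"
      using V(2) \<open>V \<subseteq> ?F\<close> by simp
    note P = power_filtration_subset[OF R(3) lin unit mult this Int_lower1]
    have "vectorspace.dim class_ring (function_space G T (power_filtration class_ring ?A V n))
        \<le> card (r ` carrier G)" for n
      using P(1)[where T = T and n = n] by (intro dim_le_card_of_functions_through[OF r(1) P(2)]) simp
    then show ?thesis
      by (rule limsup_ln_bounded_over_ln)
  qed
  have zero: "linear_function_set (carrier G) {\<lambda>x\<in>carrier G. 0}"
    by (auto simp: linear_function_set_def fun_eq_iff)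
  \<comment> \<open>A nonempty index family is required here: in \<open>ereal\<close> the supremum
    of the empty set is minus infinity.\<close>
  have "{\<lambda>x\<in>carrier G. 0} \<in> ?\<V>"
    using R(3) subspace_function_space[OF R(3) zero] fin_dim_zero_function_space
    by (auto simp: linear_function_set_def)
  have "(SUP V\<in>?\<V>. limsup (?growth V)) = (SUP V\<in>?\<V>. 0)"
    using growth by (intro SUP_cong) auto
  also have "\<dots> = 0"
    using \<open>{\<lambda>x\<in>carrier G. 0} \<in> ?\<V>\<close> by (intro SUP_const) blast
  finally show ?thesis
    by (simp add: GKdim_def R(1))
qed

end
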